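(* Let $g(n)=n$ for all $n\in\mathbb{N}$. Define polynomials $P_n(x)$ by $P_0(x)=1$ and $P_n(x)=\frac{x}{n}\sum_{k=1}^{n} g(k)\,P_{n-k}(x)$ for $n\geq 1$, and put $\Delta_n(x)=\left(P_n(x)\right)^{n+1}-\left(P_{n+1}(x)\right)^{n}$, with largest real zero $x_n$. Then $P_n(x)=\frac{x}{n}L_{n-1}^{(1)}(-x)$ for all $n\geq 1$, where $L_m^{(1)}(x)=\sum_{k=0}^{m}\binom{m+1}{m-k}\frac{(-x)^k}{k!}$ is the associated Laguerre polynomial with parameter $1$. Moreover, $x_n\leq 2$ for all $n\in\mathbb{N}$, and $x_n\leq 1$ for all $n\geq 6$.
   Context: For $n\geq 1$, $\Delta_n(x)$ is a nonzero real polynomial having $x=0$ as a real zero (since $P_n(0)=0$); $x_n$ denotes its largest real zero. *)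

theory Defs
  imports Complex_Main "HOL-Computational_Algebra.Polynomial"
begin

function P :: "(nat \<Rightarrow> real) \<Rightarrow> nat \<Rightarrow> real poly" where
  "P g n = (if n = 0 then 1
            else smult (1 / real n) ([:0, 1:] * (\<Sum>k = 1..n. smult (g k) (P g (n - k)))))"
  by auto
termination
  by (relation "measure snd") auto

declare P.simps [simp del]

definition \<Delta> :: "(nat \<Rightarrow> real) \<Rightarrow> nat \<Rightarrow> real poly" where
  "\<Delta> g n = P g n ^ (n + 1) - P g (n + 1) ^ n"

text \<open>
  \<open>Max\<close> is only meaningful for finite nonempty sets; \<open>\<Delta> g n\<close> is nonzero with a zero at \<open>0\<close>
  for \<open>n \<ge> 1\<close> and \<open>g\<close> the identity. For \<open>n = 0\<close> it vanishes identically, so \<open>n \<ge> 1\<close> is always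
  required.
\<close>

definition largest_real_zero :: "real poly \<Rightarrow> real" where
  "largest_real_zero p = Max {x. poly p x = 0}"

definition laguerre :: "nat \<Rightarrow> nat \<Rightarrow> real poly" where
  "laguerre \<alpha> m = (\<Sum>k = 0..m. smult (real ((m + \<alpha>) choose (m - k)) / fact k) ([:0, -1:] ^ k))"

end

theory Submission
  imports Defs
begin

text \<open>
  Differencing the defining convolution twice gives the three-term recurrence
  \<open>(n + 2) P\<^bsub>n+2\<^esub> = (2n + 2 + x) P\<^bsub>n+1\<^esub> - n P\<^bsub>n\<^esub>\<close>, which the Laguerre expression also satisfies.
  The recurrence yields the Turan-type identity
  \<open>(n + 1) D\<^bsub>n\<^esub> = (n - 2) D\<^bsub>n-1\<^esub> + (P\<^bsub>n\<^esub> - P\<^bsub>n-1\<^esub>)\<^sup>2\<close> for \<open>D\<^bsub>n\<^esub> = P\<^bsub>n\<^esub>\<^sup>2 - P\<^bsub>n-1\<^esub> P\<^bsub>n+1\<^esub>\<close>, so that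
  \<open>n \<mapsto> P\<^bsub>n\<^esub>(x)\<close> is log-concave on \<open>n \<ge> 1\<close> for every \<open>x > 0\<close>. Log-concavity propagates
  the inequality \<open>P\<^bsub>n+1\<^esub>\<^sup>n < P\<^bsub>n\<^esub>\<^sup>n\<^sup>+\<^sup>1\<close> from \<open>n\<close> to \<open>n + 1\<close>, and it remains to check it for
  \<open>n = 1\<close>, \<open>x > 2\<close> and for \<open>n = 6\<close>, \<open>x > 1\<close>;
  the latter holds because \<open>P\<^bsub>6\<^esub>\<^sup>7 / P\<^bsub>7\<^esub>\<^sup>6\<close> is increasing on the positive axis and exceeds \<open>1\<close> at \<open>x = 1\<close>.
\<close>

section \<open>Elementary properties of \<open>P\<close>\<close>

text \<open>The recursion evaluates its weights only at \<open>k \<ge> 1\<close>, so a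
  \<open>g\<close> prescribed at positive arguments can be replaced by \<open>real\<close>.\<close>

lemma P_cong:
  assumes "\<And>k. k \<ge> 1 \<Longrightarrow> g k = h k"
  shows "P g n = P h n"
proof (induction n rule: less_induct)
  case (less n)
  have "(\<Sum>k = 1..n. smult (g k) (P g (n - k))) = (\<Sum>k = 1..n. smult (h k) (P h (n - k)))"
    by (rule sum.cong) (auto simp: assms less.IH)
  then show ?case
    by (subst (1 2) P.simps) simp
qed

lemma P_0 [simp]: "P g 0 = 1"
  by (simp add: P.simps)

lemma poly_P_pos:
  assumes "x > 0" "\<And>k. k \<ge> 1 \<Longrightarrow> g k > 0"
  shows "poly (P g n) x > 0"
proof (induction n rule: less_induct)
  case (less n)
  show ?case
  proof (cases "n = 0")
    case False
    have "(\<Sum>k = 1..n. g k * poly (P g (n - k)) x) > 0"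
      using False by (intro sum_pos) (auto intro!: mult_pos_pos assms less.IH)
    then show ?thesis
      using False assms by (subst P.simps) (simp add: poly_sum)
  qed simp
qed

lemma poly_P_at_0: "n \<ge> 1 \<Longrightarrow> poly (P g n) 0 = 0"
  by (subst P.simps) simp

section \<open>Three-term recurrence\<close>

lemma P_convolution:
  "smult (real n) (P real n) = [:0, 1:] * (\<Sum>j<n. smult (real (n - j)) (P real j))"
proof (cases "n = 0")
  case False
  have "(\<Sum>k = 1..n. smult (real k) (P real (n - k))) = (\<Sum>j<n. smult (real (n - j)) (P real j))"
    by (rule sum.reindex_bij_witness[of _ "\<lambda>j. n - j" "\<lambda>k. n - k"]) auto
  then show ?thesis
    using False by (subst P.simps) simp
qed simp

lemma P_recurrence:
  "smult (real (n + 2)) (P real (n + 2)) = [:real (2 * n + 2), 1:] * P real (n + 1) - smult (real n) (P real n)"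
proof -
  define U where "U n = (\<Sum>j<n. smult (real (n - j)) (P real j))" for n
  have U_Suc: "U (Suc n) = U n + (\<Sum>j\<le>n. P real j)" for n
  proof -
    \<comment> \<open>The term \<open>j = n\<close> of \<open>U n\<close> has weight 0, so its range
      may be extended to \<open>j \<le> n\<close>.\<close>
    have "U (Suc n) = (\<Sum>j\<le>n. smult (real (n - j)) (P real j) + P real j)"
      unfolding U_def lessThan_Suc_atMost
      by (rule sum.cong) (auto simp: Suc_diff_le smult_add_left)
    then show ?thesis
      by (simp add: sum.distrib U_def lessThan_Suc_atMost[symmetric])
  qed
  \<comment> \<open>The weights are linear in \<open>n\<close>, so the second difference of
    \<open>U\<close> leaves a single term.\<close>
  have "U (n + 2) = 2 * U (n + 1) - U n + P real (n + 1)"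
    by (simp add: U_Suc)
  then have "[:0, 1:] * U (n + 2) = 2 * ([:0, 1:] * U (n + 1)) - [:0, 1:] * U n + [:0, 1:] * P real (n + 1)"
    by (simp add: algebra_simps)
  moreover have "[:0, 1:] * U m = smult (real m) (P real m)" for m
    by (simp only: P_convolution U_def)
  ultimately have "smult (real (n + 2)) (P real (n + 2)) = 2 * smult (real (n + 1)) (P real (n + 1)) - smult (real n) (P real n) + [:0, 1:] * P real (n + 1)"
    by metis
  then show ?thesis
    by (simp add: algebra_simps numeral_poly flip: smult_add_left)
qed

lemma P_1: "P real (Suc 0) = [:0, 1:]"
  by (subst P.simps) simp

section \<open>Coefficients and the Laguerre form\<close>

text \<open>This is the coefficient of \<open>x^(i+2)\<close> in \<open>P_recurrence\<close> at
  \<open>n = m + 1\<close>, multiplied by \<open>(i+2)!\<close>. Absorption and Pascal's rule reduce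
  it to \<open>m choose i\<close> and \<open>m choose Suc i\<close>.\<close>

lemma binomial_recurrence:
  "real (m + 3) * real ((m + 2) choose Suc i) =
     real (2 * m + 4) * real ((m + 1) choose Suc i) - real (m + 1) * real (m choose Suc i)
     + real (i + 2) * real ((m + 1) choose i)"
proof -
  have "(real (m + 1) - real i) * real ((m + 1) choose i) = real (m + 1) * real (m choose i)"
  proof (cases "i \<le> m + 1")
    case True
    then show ?thesis
      using arg_cong[OF binomial_absorb_comp[of "m + 1" i], of real]
      by (simp add: of_nat_diff distrib_right)
  qed (simp add: binomial_eq_0)
  moreover have "real ((m + 1) choose Suc i) = real (m choose i) + real (m choose Suc i)"
    "real ((m + 2) choose Suc i) = real ((m + 1) choose i) + real ((m + 1) choose Suc i)"
    by simp_all
  ultimately show ?thesis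
    by (simp add: algebra_simps del: binomial_Suc_Suc)
qed

lemma coeff_P_Suc:
  "coeff (P real (Suc n)) k = (if k = 0 then 0 else real (n choose (k - 1)) / fact k)"
proof (induction n arbitrary: k rule: less_induct)
  case (less n)
  show ?case
  proof (cases n)
    case 0
    then show ?thesis
      by (cases k) (auto simp: P_1 coeff_pCons split: nat.splits)
  next
    case (Suc m)
    have "real (m + 2) * coeff (P real (m + 2)) k =
      coeff ([:real (2 * m + 2), 1:] * P real (m + 1) - smult (real m) (P real m)) k"
      by (metis P_recurrence coeff_smult)
    then have rec: "real (m + 2) * coeff (P real (Suc n)) k =
      real (2 * m + 2) * coeff (P real (Suc m)) k
      + (if k = 0 then 0 else coeff (P real (Suc m)) (k - 1)) - real m * coeff (P real m) k"
      by (simp add: Suc coeff_pCons split: nat.splits)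
    have IH1: "coeff (P real (Suc m)) k = (if k = 0 then 0 else real (m choose (k - 1)) / fact k)" for k
      using less.IH[of m] Suc by simp
    \<comment> \<open>The induction hypothesis speaks of successor indices; for \<open>m = 0\<close>
      the factor \<open>real m\<close> kills the term.\<close>
    have IH0: "real m * coeff (P real m) k =
      (if k = 0 then 0 else real m * real ((m - 1) choose (k - 1)) / fact k)"
      using less.IH[of "m - 1"] Suc by (cases m) auto
    have "real (m + 2) * coeff (P real (Suc n)) k =
      real (m + 2) * (if k = 0 then 0 else real (n choose (k - 1)) / fact k)"
    proof (cases k)
      case 0
      then show ?thesis using rec IH0 IH1 by simp
    next
      case (Suc j)
      note k = this
      have "real (m + 2) * real (Suc m choose j) = real (2 * m + 2) * real (m choose j)
          - real m * real ((m - 1) choose j) + (if j = 0 then 0 else real (j + 1) * real (m choose (j - 1)))"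
      proof (cases j)
        case (Suc i)
        show ?thesis
        proof (cases m)
          case 0
          then show ?thesis using Suc by (cases i) auto
        next
          case (Suc m')
          then show ?thesis
            using binomial_recurrence[of m' i] \<open>j = Suc i\<close> by (simp add: algebra_simps)
        qed
      qed (simp add: algebra_simps)
      \<comment> \<open>Multiplication by \<open>x\<close> shifts the coefficient index, and the
        factor \<open>j + 1\<close> absorbs the resulting change of factorial.\<close>
      moreover have frac: "real (j + 1) * c / fact (Suc j) = c / fact j" for c
        unfolding fact_Suc Suc_eq_plus1[symmetric] by (rule mult_divide_mult_cancel_left) simp
      ultimately have "real (m + 2) * (real (Suc m choose j) / fact (Suc j)) =
        real (2 * m + 2) * (real (m choose j) / fact (Suc j))
        - real m * real ((m - 1) choose j) / fact (Suc j)
        + (if j = 0 then 0 else real (m choose (j - 1)) / fact j)"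
        using frac by (cases "j = 0") (simp_all only: times_divide_eq_right add_divide_distrib diff_divide_distrib if_True if_False simp_thms add_0_right div_0)
      then show ?thesis
        unfolding rec IH0 IH1 using k \<open>n = Suc m\<close> by simp
    qed
    then show ?thesis by simp
  qed
qed

lemma poly_P_Suc:
  "poly (P real (Suc n)) x = (\<Sum>k\<le>n. real (n choose k) / fact (Suc k) * x ^ Suc k)"
proof -
  have "P real (Suc n) = (\<Sum>k\<le>n. monom (real (n choose k) / fact (Suc k)) (Suc k))"
  proof (rule poly_eqI)
    fix i
    show "coeff (P real (Suc n)) i = coeff (\<Sum>k\<le>n. monom (real (n choose k) / fact (Suc k)) (Suc k)) i"
      by (cases i) (auto simp: coeff_P_Suc coeff_sum)
  qed
  then show ?thesis
    by (simp add: poly_sum poly_monom)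
qed

lemma poly_P_laguerre:
  assumes "n \<ge> 1"
  shows "poly (P real n) x = x / real n * poly (laguerre 1 (n - 1)) (- x)"
proof -
  obtain m where n: "n = Suc m"
    using assms by (cases n) auto
  have "real (m choose k) / fact (Suc k) * x ^ Suc k =
      x / real n * (real (Suc m choose (m - k)) / fact k * x ^ k)" if "k \<le> m" for k
  proof -
    have "Suc m choose (m - k) = Suc m choose Suc k"
      using that by (subst binomial_symmetric) auto
    moreover have "real (Suc k) * real (Suc m choose Suc k) = real (Suc m) * real (m choose k)"
      by (metis Suc_times_binomial of_nat_mult)
    ultimately show ?thesis
      unfolding n by (simp add: field_simps del: binomial_Suc_Suc of_nat_Suc)
  qed
  then show ?thesis
    unfolding n poly_P_Suc laguerre_def
    by (simp add: poly_sum sum_distrib_left atLeast0AtMost n)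
qed

section \<open>Log-concavity and its propagation\<close>

text \<open>The start at \<open>n = 1\<close> matters: for \<open>n = 0\<close> the difference of
  the two sides is \<open>x^2/2 - x\<close>, negative for \<open>0 < x < 2\<close>.\<close>

lemma P_log_concave:
  assumes "n \<ge> 1"
  shows "poly (P real n) x * poly (P real (n + 2)) x \<le> (poly (P real (n + 1)) x)\<^sup>2"
  using assms
proof (induction n rule: nat_induct_at_least)
  let ?p = "\<lambda>n. poly (P real n) x"
  have rec: "real (n + 2) * ?p (n + 2) = (real (2 * n + 2) + x) * ?p (n + 1) - real n * ?p n" for n
    using arg_cong[OF P_recurrence[of n], of "\<lambda>q. poly q x"] by (simp add: algebra_simps)
  {
    case base
    have "?p 2 = x + x\<^sup>2 / 2" "?p 3 = x + x\<^sup>2 + x ^ 3 / 6"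
      using poly_P_Suc[of 1 x] poly_P_Suc[of 2 x] by (simp_all add: eval_nat_numeral)
    then have "(?p 2)\<^sup>2 - x * ?p 3 = x ^ 4 / 12"
      by (simp only:) (simp add: field_simps power2_eq_square power3_eq_cube power4_eq_xxxx)
    then have "x * ?p 3 \<le> (?p 2)\<^sup>2"
      by (smt (verit) zero_le_even_power even_numeral divide_nonneg_pos)
    then show ?case
      by (simp add: P_1 eval_nat_numeral)
  next
    case (Suc n)
    define a b c d where "a = ?p n" and "b = ?p (n + 1)" and "c = ?p (n + 2)" and "d = ?p (n + 3)"
    have 1: "real n * a = (real (2 * n + 2) + x) * b - real (n + 2) * c"
      using rec[of n] by (simp add: a_def b_def c_def)
    have 2: "real (n + 3) * d = (real (2 * n + 4) + x) * c - real (n + 1) * b"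
      using rec[of "n + 1"] by (simp add: b_def c_def d_def eval_nat_numeral)
    \<comment> \<open>Eliminating \<open>d\<close> by the recurrence and reintroducing
      \<open>a\<close> leaves \<open>n\<close> times the previous difference plus a square.\<close>
    have "real (n + 3) * (c\<^sup>2 - b * d) = real (n + 3) * c\<^sup>2 - b * (real (n + 3) * d)"
      by (simp add: algebra_simps)
    also have "\<dots> = real n * b\<^sup>2 - (real n * a) * c + (c - b)\<^sup>2"
      unfolding 1 2 by (simp add: algebra_simps power2_eq_square)
    also have "\<dots> = real n * (b\<^sup>2 - a * c) + (c - b)\<^sup>2"
      by (simp add: algebra_simps)
    also have "\<dots> \<ge> 0"
      using Suc.IH by (simp add: a_def b_def c_def)
    finally have "0 \<le> c\<^sup>2 - b * d"
      by (simp add: zero_le_mult_iff)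
    then show ?case
      by (simp add: b_def c_def d_def eval_nat_numeral)
  }
qed

lemma P_power_less_propagate:
  assumes "x > 0" "1 \<le> m" "m \<le> n"
    and "poly (P real (m + 1)) x ^ m < poly (P real m) x ^ (m + 1)"
  shows "poly (P real (n + 1)) x ^ n < poly (P real n) x ^ (n + 1)"
  using \<open>m \<le> n\<close>
proof (induction n rule: dec_induct)
  case (step n)
  define a b c where "a = poly (P real n) x" and "b = poly (P real (n + 1)) x"
    and "c = poly (P real (n + 2)) x"
  have pos: "a > 0" "b > 0" "c > 0"
    using \<open>x > 0\<close> by (auto simp: a_def b_def c_def intro!: poly_P_pos)
  have "a * c \<le> b\<^sup>2"
    using P_log_concave[of n x] step \<open>1 \<le> m\<close> by (simp add: a_def b_def c_def)
  then have "(a * c) ^ (n + 1) \<le> (b\<^sup>2) ^ (n + 1)"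
    using pos by (intro power_mono) auto
  \<comment> \<open>\<open>b^(2n+2)\<close> is split so that the hypothesis
    \<open>b^n < a^(n+1)\<close> applies and \<open>a^(n+1)\<close> cancels.\<close>
  then have "a ^ (n + 1) * c ^ (n + 1) \<le> b ^ n * b ^ (n + 2)"
    by (simp add: power_mult_distrib power_add power2_eq_square algebra_simps)
  also have "\<dots> < a ^ (n + 1) * b ^ (n + 2)"
    using step.IH pos by (intro mult_strict_right_mono) (auto simp: a_def b_def)
  finally have "c ^ (n + 1) < b ^ (n + 2)"
    using pos by (subst (asm) mult_less_cancel_left_pos) auto
  then show ?case
    by (simp add: b_def c_def)
qed (use assms in simp)

section \<open>Base cases and largest zeros\<close>

text \<open>The bound 2 is the positive zero of \<open>\<Delta> real 1\<close>, which is
  \<open>x^2/2 - x\<close>.\<close>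

lemma P_power_less_1:
  assumes "x > 2"
  shows "poly (P real (1 + 1)) x ^ 1 < poly (P real 1) x ^ (1 + 1)"
proof -
  have "x * 2 < x * x"
    using assms by simp
  then show ?thesis
    by (simp add: poly_P_Suc field_simps power2_eq_square)
qed

lemma P_power_less_6:
  assumes "x > 1"
  shows "poly (P real (6 + 1)) x ^ 6 < poly (P real 6) x ^ (6 + 1)"
proof -
  \<comment> \<open>\<open>a\<close> and \<open>b\<close> are \<open>P real 6\<close> and
    \<open>P real 7\<close> written out, \<open>a'\<close> and \<open>b'\<close> their derivatives;
    \<open>f\<close> below is the logarithm of \<open>a^7 / b^6\<close>.\<close>
  define a b a' b' :: "real \<Rightarrow> real" where
    a: "a = (\<lambda>x. x + 5/2 * x^2 + 5/3 * x^3 + 5/12 * x^4 + 1/24 * x^5 + 1/720 * x^6)" and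
    b: "b = (\<lambda>x. x + 3 * x^2 + 5/2 * x^3 + 5/6 * x^4 + 1/8 * x^5 + 1/120 * x^6 + 1/5040 * x^7)" and
    a': "a' = (\<lambda>x. 1 + 5 * x + 5 * x^2 + 5/3 * x^3 + 5/24 * x^4 + 1/120 * x^5)" and
    b': "b' = (\<lambda>x. 1 + 6 * x + 15/2 * x^2 + 10/3 * x^3 + 5/8 * x^4 + 1/20 * x^5 + 1/720 * x^6)"
  define f where "f = (\<lambda>x. 7 * ln (a x) - 6 * ln (b x))"
  have ab: "poly (P real 6) x = a x" "poly (P real 7) x = b x"
    using poly_P_Suc[of 5 x] poly_P_Suc[of 6 x]
    by (simp_all add: a b eval_nat_numeral fact_numeral)
  have pos: "a y > 0" "b y > 0" if "y > 0" for y
    using that by (auto simp: a b intro!: add_pos_pos)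
  have deriv_ab: "(a has_real_derivative a' y) (at y)" "(b has_real_derivative b' y) (at y)" for y
    unfolding a b a' b' by (auto intro!: derivative_eq_intros)
  have deriv: "(f has_real_derivative 7 * (a' y / a y) - 6 * (b' y / b y)) (at y)" if "y > 0" for y
    unfolding f_def using pos[OF that] by (auto intro!: derivative_eq_intros deriv_ab simp: mult.commute)
  have nonneg: "7 * (a' y / a y) - 6 * (b' y / b y) \<ge> 0" if "y > 0" for y
  proof -
    \<comment> \<open>The numerator of the derivative of \<open>f\<close> expands with positive
      coefficients only.\<close>
    have "7 * a' y * b y - 6 * b' y * a y =
        y + 5 * y^2 + 25/2 * y^3 + 15 * y^4 + 10 * y^5 + 59/15 * y^6 + 17/18 * y^7
        + 5/36 * y^8 + 7/576 * y^9 + 1/1728 * y^10 + 1/86400 * y^11"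
      unfolding a b a' b' by (simp add: field_simps eval_nat_numeral)
    also have "\<dots> \<ge> 0"
      using that by simp
    finally have "6 * b' y * a y \<le> 7 * a' y * b y"
      by linarith
    then have "6 * b' y / b y \<le> 7 * a' y / a y"
      using pos[OF that] by (simp add: divide_simps)
    then show ?thesis
      by simp
  qed
  have "f 1 \<le> f x"
  proof (rule DERIV_nonneg_imp_nondecreasing[where f = f])
    fix y :: real
    assume "1 \<le> y"
    then have "y > 0"
      by simp
    then show "\<exists>d. (f has_real_derivative d) (at y) \<and> 0 \<le> d"
      using deriv nonneg by blast
  qed (use assms in simp)
  moreover have "ln (b 1 ^ 6) < ln (a 1 ^ 7)"
    by (subst ln_less_cancel_iff) (simp_all add: a b field_simps)
  then have "f 1 > 0"
    using pos[of 1] by (simp add: ln_realpow f_def)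
  ultimately have "ln (b x ^ 6) < ln (a x ^ 7)"
    using pos[of x] assms by (simp add: ln_realpow f_def)
  then have "b x ^ 6 < a x ^ 7"
    using pos[of x] assms by simp
  then show ?thesis
    by (simp add: ab)
qed

text \<open>The inequality excludes zeros beyond \<open>c\<close>. At \<open>c + 1\<close> it also
  shows the polynomial nonzero, so the zero set is finite; it contains 0, so \<open>Max\<close> is
  meaningful.\<close>

lemma largest_real_zero_\<Delta>_le:
  assumes "n \<ge> 1" "c \<ge> 0"
    and less: "\<And>x. x > c \<Longrightarrow> poly (P real (n + 1)) x ^ n < poly (P real n) x ^ (n + 1)"
  shows "largest_real_zero (\<Delta> real n) \<le> c"
proof -
  have no_zero: "poly (\<Delta> real n) x \<noteq> 0" if "x > c" for x
    using less[OF that] by (simp add: \<Delta>_def poly_power)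
  from no_zero[of "c + 1"] have "\<Delta> real n \<noteq> 0"
    by auto
  then have "finite {x. poly (\<Delta> real n) x = 0}"
    by (rule poly_roots_finite)
  moreover have "poly (\<Delta> real n) 0 = 0"
    using \<open>n \<ge> 1\<close> by (simp add: \<Delta>_def poly_power poly_P_at_0)
  ultimately show ?thesis
    unfolding largest_real_zero_def using no_zero by (subst Max_le_iff) (auto intro: leI)
qed

theorem theorem1p2:
  fixes g :: "nat \<Rightarrow> real"
  assumes g: "\<And>n. n \<ge> 1 \<Longrightarrow> g n = real n"
  shows "(\<forall>n\<ge>1. \<forall>x. poly (P g n) x = x / real n * poly (laguerre 1 (n - 1)) (- x)) \<and>
         (\<forall>n\<ge>1. largest_real_zero (\<Delta> g n) \<le> 2) \<and>
         (\<forall>n\<ge>6. largest_real_zero (\<Delta> g n) \<le> 1)"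
proof -
  have P: "P g n = P real n" for n
    using g by (rule P_cong)
  have \<Delta>: "\<Delta> g n = \<Delta> real n" for n
    by (simp add: \<Delta>_def P)
  have "largest_real_zero (\<Delta> real n) \<le> 2" if "n \<ge> 1" for n
    using that P_power_less_1 P_power_less_propagate[of _ 1 n]
    by (intro largest_real_zero_\<Delta>_le) auto
  moreover have "largest_real_zero (\<Delta> real n) \<le> 1" if "n \<ge> 6" for n
    using that P_power_less_6 P_power_less_propagate[of _ 6 n]
    by (intro largest_real_zero_\<Delta>_le) auto
  ultimately show ?thesis
    unfolding P \<Delta> using poly_P_laguerre by blast
qed

end
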